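(* There exist numerical constants $C,c>0$ such that, for any $n\in\mathbb{N}$ and any pair of ellipsoids $\mathcal{E},\mathcal{B}\subset\mathbb{R}^n$, one has \[\log M(\mathcal{E},\mathcal{B})\le C\log \hat{M}(\mathcal{E}, c\,\mathcal{B}).\]
   Context: Ellipsoids are (origin-symmetric, nondegenerate) sets of the form $T(B_2^n)$ with $B_2^n$ the closed Euclidean unit ball and $T$ an invertible linear map. Logarithms are to base 2. For a set $K$ and a symmetric convex body $B$, the packing number $M(K,B)$ is the maximal number of translates $x_i+B$ with $x_i\in K$ whose interiors are pairwise disjoint (possibly $+\infty$). The convex separation number is \[\hat{M}(K,B):=\sup\{N:\ \exists\, x_1,\dots,x_N\in K \text{ such that } (x_j+\mathrm{int}\,B)\cap \mathrm{conv}\{x_i: i<j\}=\emptyset \text{ for all } j\},\] where $\mathrm{int}$ denotes interior and $\mathrm{conv}$ the convex hull (possibly $+\infty$). *)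

theory Defs
  imports "HOL-Analysis.Analysis" "HOL-Library.Extended_Nat"
begin

text \<open>Euclidean space R^n is modelled inside \<open>nat \<Rightarrow> real\<close> as the vectors
  supported on the coordinates \<open>{..<n}\<close>; this lets the dimension n be quantified
  inside the statement (the constants C, c must be independent of n).\<close>

definition Rn :: "nat \<Rightarrow> (nat \<Rightarrow> real) set" where
  "Rn n = {x. \<forall>i\<ge>n. x i = 0}"

definition enorm :: "nat \<Rightarrow> (nat \<Rightarrow> real) \<Rightarrow> real" where
  "enorm n x = sqrt (\<Sum>i<n. (x i)\<^sup>2)"

definition unit_ball :: "nat \<Rightarrow> (nat \<Rightarrow> real) set" where
  "unit_ball n = {x \<in> Rn n. enorm n x \<le> 1}"

definition mat_app :: "nat \<Rightarrow> (nat \<Rightarrow> nat \<Rightarrow> real) \<Rightarrow> (nat \<Rightarrow> real) \<Rightarrow> (nat \<Rightarrow> real)" where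
  "mat_app n A x = (\<lambda>i. if i < n then (\<Sum>j<n. A i j * x j) else 0)"

definition invertible_mat :: "nat \<Rightarrow> (nat \<Rightarrow> nat \<Rightarrow> real) \<Rightarrow> bool" where
  "invertible_mat n A \<longleftrightarrow> (\<exists>B. \<forall>x\<in>Rn n. mat_app n B (mat_app n A x) = x \<and> mat_app n A (mat_app n B x) = x)"

definition ellipsoid :: "nat \<Rightarrow> (nat \<Rightarrow> real) set \<Rightarrow> bool" where
  "ellipsoid n E \<longleftrightarrow> (\<exists>A. invertible_mat n A \<and> E = mat_app n A ` unit_ball n)"

definition scale_set :: "real \<Rightarrow> (nat \<Rightarrow> real) set \<Rightarrow> (nat \<Rightarrow> real) set" where
  "scale_set c S = (\<lambda>y. (\<lambda>i. c * y i)) ` S"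

definition transl :: "(nat \<Rightarrow> real) \<Rightarrow> (nat \<Rightarrow> real) set \<Rightarrow> (nat \<Rightarrow> real) set" where
  "transl x S = (\<lambda>y. (\<lambda>i. x i + y i)) ` S"

definition int_n :: "nat \<Rightarrow> (nat \<Rightarrow> real) set \<Rightarrow> (nat \<Rightarrow> real) set" where
  "int_n n S = {x \<in> Rn n. \<exists>e>0. \<forall>y\<in>Rn n. enorm n (\<lambda>i. y i - x i) < e \<longrightarrow> y \<in> S}"

definition conv :: "(nat \<Rightarrow> real) set \<Rightarrow> (nat \<Rightarrow> real) set" where
  "conv S = {y. \<exists>k (u::nat \<Rightarrow> real) p. (\<forall>i<k. 0 \<le> u i \<and> p i \<in> S) \<and> (\<Sum>i<k. u i) = 1
                 \<and> y = (\<lambda>t. \<Sum>i<k. u i * p i t)}"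

definition packing_number :: "nat \<Rightarrow> (nat \<Rightarrow> real) set \<Rightarrow> (nat \<Rightarrow> real) set \<Rightarrow> enat" where
  "packing_number n K B = Sup {enat N | N. \<exists>x::nat \<Rightarrow> (nat \<Rightarrow> real).
      (\<forall>i<N. x i \<in> K) \<and>
      (\<forall>i<N. \<forall>j<N. i \<noteq> j \<longrightarrow> int_n n (transl (x i) B) \<inter> int_n n (transl (x j) B) = {})}"

definition conv_sep_number :: "nat \<Rightarrow> (nat \<Rightarrow> real) set \<Rightarrow> (nat \<Rightarrow> real) set \<Rightarrow> enat" where
  "conv_sep_number n K B = Sup {enat N | N. \<exists>x::nat \<Rightarrow> (nat \<Rightarrow> real).
      (\<forall>i<N. x i \<in> K) \<and>
      (\<forall>j<N. transl (x j) (int_n n B) \<inter> conv {x i | i. i < j} = {})}"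

end

theory Submission
  imports Defs
begin

text \<open>
  After a linear change of variables \<open>\<B>\<close> is the unit ball and \<open>\<E>\<close> has semi-axes
  \<open>a\<^sub>0 \<ge> a\<^sub>1 \<ge> \<dots>\<close> along the coordinates. Let F be the ellipsoid with semi-axes \<open>sqrt a\<^sub>i\<close>.

  Upper bound: with \<open>D = diag (sqrt a)\<close> we have \<open>\<E> = D F\<close> and F is the D-image of the ball, so
  \<open>N(\<E>, ball) \<le> N(D F, D ball) N(F, ball) = N(F, ball)\<^sup>2\<close>. Up to the factor \<open>a\<^sub>0\<close>, which counts the
  possible 0-th coordinates, the covering number of F is that of its section by \<open>x\<^sub>0 = 0\<close>.

  Lower bound: a point z of that section is lifted to the point of \<open>\<E>\<close> with 0-th coordinate
  \<open>\<Sum> z\<^sub>i\<^sup>2 / 2\<close> and i-th coordinate \<open>sqrt a\<^sub>i z\<^sub>i / 2\<close>. The lifted points lie on a paraboloid of bounded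
  slope, so if the z's are separated then each lifted point is far from the convex hull of the
  others. The factor \<open>a\<^sub>0\<close> is accounted for by equidistant points on the longest axis.
\<close>

section \<open>Orthonormal systems and singular values\<close>

definition dotp :: "nat \<Rightarrow> (nat \<Rightarrow> real) \<Rightarrow> (nat \<Rightarrow> real) \<Rightarrow> real" where
  "dotp n x y = (\<Sum>i<n. x i * y i)"

text \<open>\<open>dotp n\<close> reads only the coordinates below n. Membership in
  \<open>Rn n\<close> fixes the others, so that expansions in \<open>u\<close> can be equalities of
  functions.\<close>

definition orthonormal :: "nat \<Rightarrow> nat \<Rightarrow> (nat \<Rightarrow> nat \<Rightarrow> real) \<Rightarrow> bool" where
  "orthonormal n k u \<longleftrightarrow> (\<forall>i<k. u i \<in> Rn n) \<and>
     (\<forall>i<k. \<forall>j<k. dotp n (u i) (u j) = (if i = j then 1 else 0))"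

lemma dotp_commute: "dotp n x y = dotp n y x"
  by (simp add: dotp_def mult.commute)

lemma dotp_add_right: "dotp n x (\<lambda>t. y t + z t) = dotp n x y + dotp n x z"
  by (simp add: dotp_def algebra_simps sum.distrib)

lemma dotp_diff_right: "dotp n x (\<lambda>t. y t - z t) = dotp n x y - dotp n x z"
  by (simp add: dotp_def algebra_simps sum_subtractf)

lemma dotp_scale_right: "dotp n x (\<lambda>t. c * y t) = c * dotp n x y"
  by (simp add: dotp_def algebra_simps sum_distrib_left)

lemma dotp_sum_right:
  "dotp n x (\<lambda>t. \<Sum>i<(k::nat). c i * y i t) = (\<Sum>i<k. c i * dotp n x (y i))"
  unfolding dotp_def sum_distrib_left
  by (subst sum.swap) (simp add: algebra_simps)

lemma dotp_add_left: "dotp n (\<lambda>t. y t + z t) x = dotp n y x + dotp n z x"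
  by (metis dotp_add_right dotp_commute)

lemma dotp_diff_left: "dotp n (\<lambda>t. y t - z t) x = dotp n y x - dotp n z x"
  by (metis dotp_diff_right dotp_commute)

lemma dotp_scale_left: "dotp n (\<lambda>t. c * y t) x = c * dotp n y x"
  by (metis dotp_scale_right dotp_commute)

lemma dotp_sum_left:
  "dotp n (\<lambda>t. \<Sum>i<(k::nat). c i * y i t) x = (\<Sum>i<k. c i * dotp n (y i) x)"
  by (metis (no_types, lifting) dotp_sum_right dotp_commute sum.cong)

lemmas dotp_bilinear = dotp_add_right dotp_diff_right dotp_scale_right dotp_sum_right
  dotp_add_left dotp_diff_left dotp_scale_left dotp_sum_left

lemma dotp_self_eq: "dotp n x x = (\<Sum>i<n. (x i)\<^sup>2)"
  by (simp add: dotp_def power2_eq_square)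

lemma dotp_self_nonneg: "0 \<le> dotp n x x"
  by (simp add: dotp_self_eq sum_nonneg)

lemma enorm_eq: "enorm n x = sqrt (dotp n x x)"
  by (simp add: enorm_def dotp_self_eq)

lemma dotp_self_eq_0_iff: "dotp n x x = 0 \<longleftrightarrow> (\<forall>i<n. x i = 0)"
  unfolding dotp_self_eq by (subst sum_nonneg_eq_0_iff) auto

lemma dotp_Cauchy_Schwarz: "(dotp n x y)\<^sup>2 \<le> dotp n x x * dotp n y y"
  using Cauchy_Schwarz_ineq_sum[of x y "{..<n}"] by (simp add: dotp_def power2_eq_square)

text \<open>\<open>r x\<close> is x minus its orthogonal projection onto the span of the
  \<open>u i\<close>. The norm formula is Pythagoras; its nonnegativity is Bessel's
  inequality.\<close>

lemma orthonormal_residual: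
  assumes "orthonormal n k u"
  defines "r \<equiv> \<lambda>x t. x t - (\<Sum>i<k. dotp n x (u i) * u i t)"
  shows "j < k \<Longrightarrow> dotp n (r x) (u j) = 0"
    and "dotp n (r x) (r x) = dotp n x x - (\<Sum>i<k. (dotp n x (u i))\<^sup>2)"
proof -
  have perp: "dotp n (r x) (u j) = 0" if "j < k" for j
  proof -
    have "(\<Sum>i<k. dotp n x (u i) * dotp n (u i) (u j)) = (\<Sum>i<k. if i = j then dotp n x (u j) else 0)"
      using assms(1) that by (intro sum.cong) (auto simp: orthonormal_def)
    also have "\<dots> = dotp n x (u j)" using that by simp
    finally show ?thesis by (simp add: r_def dotp_bilinear)
  qed
  then show "j < k \<Longrightarrow> dotp n (r x) (u j) = 0" .
  \<comment> \<open>Only one of the two factors is expanded, so its projection part meets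
    \<open>r x\<close> and vanishes.\<close>
  have "dotp n (r x) (r x) = dotp n (r x) x - (\<Sum>i<k. dotp n x (u i) * dotp n (r x) (u i))"
    by (subst (2) r_def) (simp add: dotp_bilinear)
  also have "\<dots> = dotp n (r x) x" using perp by simp
  also have "\<dots> = dotp n x x - (\<Sum>i<k. (dotp n x (u i))\<^sup>2)"
    by (simp add: r_def dotp_bilinear dotp_commute power2_eq_square)
  finally show "dotp n (r x) (r x) = dotp n x x - (\<Sum>i<k. (dotp n x (u i))\<^sup>2)" .
qed

text \<open>Summing Bessel's inequality over the standard basis compares k with n; no rank or
  dimension theory is needed.\<close>

lemma orthonormal_residual_trace:
  assumes "orthonormal n k u"
  shows "(\<Sum>j<n. 1 - (\<Sum>i<k. (u i j)\<^sup>2)) = real n - real k"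
proof -
  have "(\<Sum>j<n. \<Sum>i<k. (u i j)\<^sup>2) = (\<Sum>i<k. dotp n (u i) (u i))"
    unfolding dotp_self_eq by (rule sum.swap)
  also have "\<dots> = real k" using assms by (simp add: orthonormal_def)
  finally show ?thesis by (simp add: sum_subtractf)
qed

definition unit_vec :: "nat \<Rightarrow> nat \<Rightarrow> real" where
  "unit_vec j t = (if t = j then 1 else 0)"

lemma dotp_unit_vec: "j < n \<Longrightarrow> dotp n (unit_vec j) x = x j"
proof -
  assume "j < n"
  have "dotp n (unit_vec j) x = (\<Sum>i<n. if i = j then x j else 0)"
    unfolding dotp_def by (intro sum.cong) (auto simp: unit_vec_def)
  then show ?thesis using \<open>j < n\<close> by simp
qed

text \<open>The residuals of the standard basis have squared norms summing to n - k > 0, so one of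
  them is nonzero and can be normalised.\<close>

lemma orthonormal_extend:
  assumes "orthonormal n k u" "k < n"
  shows "\<exists>v\<in>Rn n. dotp n v v = 1 \<and> (\<forall>i<k. dotp n v (u i) = 0)"
proof -
  have "0 < (\<Sum>j<n. 1 - (\<Sum>i<k. (u i j)\<^sup>2))"
    using assms by (simp add: orthonormal_residual_trace)
  then obtain j where j: "j < n" "0 < 1 - (\<Sum>i<k. (u i j)\<^sup>2)"
    using sum_nonpos[of "{..<n}" "\<lambda>j. 1 - (\<Sum>i<k. (u i j)\<^sup>2)"]
    by (meson lessThan_iff linorder_not_less)
  define r where "r = (\<lambda>t. unit_vec j t - (\<Sum>i<k. dotp n (unit_vec j) (u i) * u i t))"
  have rr: "dotp n r r = 1 - (\<Sum>i<k. (u i j)\<^sup>2)"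
    using orthonormal_residual(2)[OF assms(1), of "unit_vec j"] j(1)
    by (simp add: r_def dotp_unit_vec) (simp add: unit_vec_def)
  have perp: "dotp n r (u i) = 0" if "i < k" for i
    using orthonormal_residual(1)[OF assms(1) that, of "unit_vec j"] by (simp add: r_def)
  have "r \<in> Rn n"
    using assms(1) j(1) by (auto simp: r_def Rn_def orthonormal_def unit_vec_def)
  define s where "s = 1 / sqrt (dotp n r r)"
  have "s * s * dotp n r r = 1" using rr j(2) by (simp add: s_def field_simps)
  with \<open>r \<in> Rn n\<close> perp show ?thesis
    by (intro bexI[of _ "\<lambda>t. s * r t"]) (auto simp: dotp_bilinear Rn_def)
qed

text \<open>For k = n the squared norms of the residuals sum to 0, so every basis vector equals its
  own expansion in \<open>u\<close>.\<close>

lemma orthonormal_resolution_identity: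
  assumes "orthonormal n n u" "s < n" "t < n"
  shows "(\<Sum>i<n. u i s * u i t) = (if s = t then 1 else 0)"
proof -
  define r where "r = (\<lambda>j t. unit_vec j t - (\<Sum>i<n. dotp n (unit_vec j) (u i) * u i t))"
  have rr: "dotp n (r j) (r j) = 1 - (\<Sum>i<n. (u i j)\<^sup>2)" if "j < n" for j
    using orthonormal_residual(2)[OF assms(1), of "unit_vec j"] that
    by (simp add: r_def dotp_unit_vec) (simp add: unit_vec_def)
  have "(\<Sum>j<n. dotp n (r j) (r j)) = 0"
    using orthonormal_residual_trace[OF assms(1)] by (simp add: rr)
  then have "dotp n (r s) (r s) = 0"
    using assms(2) by (subst (asm) sum_nonneg_eq_0_iff) (auto simp: dotp_self_nonneg)
  then have "r s t = 0" using assms(3) by (simp add: dotp_self_eq_0_iff)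
  then show ?thesis using assms by (auto simp: r_def dotp_unit_vec unit_vec_def)
qed

lemma orthonormal_expansion:
  assumes "orthonormal n n u" "t < n"
  shows "(\<Sum>i<n. dotp n x (u i) * u i t) = x t"
proof -
  have "(\<Sum>i<n. dotp n x (u i) * u i t) = (\<Sum>i<n. \<Sum>s<n. x s * (u i s * u i t))"
    by (simp add: dotp_def sum_distrib_right mult.assoc)
  also have "\<dots> = (\<Sum>s<n. x s * (\<Sum>i<n. u i s * u i t))"
    by (subst sum.swap) (simp add: sum_distrib_left)
  also have "\<dots> = (\<Sum>s<n. if s = t then x t else 0)"
    using orthonormal_resolution_identity[OF assms(1) _ assms(2)] by (intro sum.cong) auto
  finally show ?thesis using assms(2) by simp
qed

lemma orthonormal_Parseval:
  assumes "orthonormal n n u"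
  shows "(\<Sum>i<n. (dotp n x (u i))\<^sup>2) = dotp n x x"
proof -
  \<comment> \<open>The expansion is known to agree with x below n, and these coordinates are all
    that \<open>dotp n\<close> reads.\<close>
  have "dotp n x y = dotp n x x" if "\<And>t. t < n \<Longrightarrow> y t = x t" for y
    using that by (simp add: dotp_def)
  from this[of "\<lambda>t. \<Sum>i<n. dotp n x (u i) * u i t", OF orthonormal_expansion[OF assms]]
  have "dotp n x (\<lambda>t. \<Sum>i<n. dotp n x (u i) * u i t) = dotp n x x" .
  then show ?thesis by (simp add: dotp_bilinear power2_eq_square)
qed

lemma dotp_orthonormal_combination:
  assumes "orthonormal n k u" "i < k"
  shows "dotp n (\<lambda>t. \<Sum>j<k. c j * u j t) (u i) = c i"
proof -
  have "(\<Sum>j<k. c j * dotp n (u j) (u i)) = (\<Sum>j<k. if j = i then c i else 0)"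
    using assms by (intro sum.cong) (auto simp: orthonormal_def)
  then show ?thesis using assms(2) by (simp add: dotp_bilinear)
qed

section \<open>Compactness of the unit ball and singular values by successive maximisation\<close>

lemma continuous_on_dotp:
  fixes f g :: "(nat \<Rightarrow> real) \<Rightarrow> nat \<Rightarrow> real"
  assumes "\<And>i. continuous_on S (\<lambda>x. f x i)" "\<And>i. continuous_on S (\<lambda>x. g x i)"
  shows "continuous_on S (\<lambda>x. dotp n (f x) (g x))"
  unfolding dotp_def by (intro continuous_intros assms)

lemma continuous_on_coord: "continuous_on S (\<lambda>x::nat \<Rightarrow> real. x i)"
  by (rule continuous_on_subset[OF continuous_on_product_coordinates]) simp

text \<open>Functions on \<open>nat\<close> carry the product topology, so Tychonoff applies: the
  ball is a closed subset of a product of compact intervals, which shrink to \<open>{0}\<close> from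
  coordinate n on.\<close>

lemma compact_unit_ball: "compact (unit_ball n)"
proof -
  define K :: "nat \<Rightarrow> real set" where "K i = (if i < n then {-1..1} else {0})" for i
  have "compactin (product_topology (\<lambda>i. euclidean) UNIV) (PiE UNIV K)"
    by (subst compactin_PiE) (auto simp: K_def)
  then have cK: "compact (PiE UNIV K)"
    by (simp add: euclidean_product_topology)
  have cl: "closed {x. dotp n x x \<le> 1}"
    by (intro closed_Collect_le continuous_on_dotp continuous_on_coord continuous_on_const)
  have "unit_ball n = PiE UNIV K \<inter> {x. dotp n x x \<le> 1}"
  proof (intro equalityI subsetI)
    fix x assume x: "x \<in> unit_ball n"
    then have d: "dotp n x x \<le> 1" and R: "x \<in> Rn n"
      by (auto simp: unit_ball_def enorm_eq)
    have "x i \<in> K i" for i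
    proof (cases "i < n")
      case True
      have "(x i)\<^sup>2 \<le> dotp n x x"
        unfolding dotp_self_eq using True by (intro member_le_sum) auto
      then have "\<bar>x i\<bar> \<le> 1" using d abs_square_le_1[of "x i"] by simp
      then show ?thesis using True by (auto simp: K_def)
    qed (use R in \<open>auto simp: K_def Rn_def\<close>)
    then show "x \<in> PiE UNIV K \<inter> {x. dotp n x x \<le> 1}" using d by auto
  next
    fix x assume x: "x \<in> PiE UNIV K \<inter> {x. dotp n x x \<le> 1}"
    have "x i = 0" if "i \<ge> n" for i
      using x PiE_mem[of x UNIV K i] that by (simp add: K_def)
    then show "x \<in> unit_ball n"
      using x by (simp add: unit_ball_def enorm_eq Rn_def)
  qed
  then show ?thesis using cK cl by (simp add: compact_Int_closed)
qed

text \<open>One identity encodes linearity: \<open>c = 1\<close> is additivity,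
  \<open>c = -1\<close> with \<open>y = x\<close> gives \<open>T 0 = 0\<close>, and then
  \<open>x = 0\<close> gives homogeneity.\<close>

definition lin_map :: "((nat \<Rightarrow> real) \<Rightarrow> nat \<Rightarrow> real) \<Rightarrow> bool" where
  "lin_map T \<longleftrightarrow> (\<forall>x y c. T (\<lambda>t. x t + c * y t) = (\<lambda>t. T x t + c * T y t))"

lemma lin_mapD: "lin_map T \<Longrightarrow> T (\<lambda>t. x t + c * y t) = (\<lambda>t. T x t + c * T y t)"
  by (simp add: lin_map_def)

text \<open>Greedy choice: \<open>u i\<close> maximises the norm of \<open>T\<close> over unit
  vectors orthogonal to the earlier ones. The homogeneous form of the maximality covers vectors of
  every length.\<close>

lemma ex_maximal_orthonormal:
  assumes "\<And>i. continuous_on UNIV (\<lambda>x. T x i)" "lin_map T" "k \<le> n"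
  shows "\<exists>u. orthonormal n k u \<and>
    (\<forall>i<k. \<forall>v\<in>Rn n. (\<forall>j<i. dotp n v (u j) = 0) \<longrightarrow>
       dotp n (T v) (T v) \<le> dotp n (T (u i)) (T (u i)) * dotp n v v)"
  using \<open>k \<le> n\<close>
proof (induction k)
  case 0
  then show ?case by (simp add: orthonormal_def)
next
  case (Suc k)
  then obtain u where u: "orthonormal n k u"
    and mx: "\<And>i v. i < k \<Longrightarrow> v \<in> Rn n \<Longrightarrow> \<forall>j<i. dotp n v (u j) = 0 \<Longrightarrow>
      dotp n (T v) (T v) \<le> dotp n (T (u i)) (T (u i)) * dotp n v v"
    by (auto simp: less_imp_le)
  have T0: "T (\<lambda>t. 0 * x t) = (\<lambda>t. 0)" for x
  proof -
    have "T (\<lambda>t. x t + (-1) * x t) = (\<lambda>t. T x t + (-1) * T x t)"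
      by (rule lin_mapD[OF assms(2)])
    then show ?thesis by simp
  qed
  have Tscale: "T (\<lambda>t. c * x t) = (\<lambda>t. c * T x t)" for c x
  proof -
    have "T (\<lambda>t. 0 * x t + c * x t) = (\<lambda>t. T (\<lambda>t. 0 * x t) t + c * T x t)"
      by (rule lin_mapD[OF assms(2), of "\<lambda>t. 0 * x t"])
    then show ?thesis unfolding T0 by simp
  qed
  \<comment> \<open>The unit sphere of the orthogonal complement of the vectors chosen so far:
    compact, and nonempty because k < n.\<close>
  define S where "S = unit_ball n \<inter> {v. dotp n v v = 1} \<inter> (\<Inter>j\<in>{..<k}. {v. dotp n v (u j) = 0})"
  have "closed ({v. dotp n v v = 1} \<inter> (\<Inter>j\<in>{..<k}. {v. dotp n v (u j) = 0}))"
    by (intro closed_Int closed_INT ballI closed_Collect_eq continuous_on_dotp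
        continuous_on_coord continuous_on_const)
  then have "compact S" unfolding S_def Int_assoc
    by (intro compact_Int_closed compact_unit_ball)
  moreover have "S \<noteq> {}"
    using orthonormal_extend[OF u] Suc.prems by (auto simp: S_def unit_ball_def enorm_eq)
  moreover have "continuous_on S (\<lambda>v. dotp n (T v) (T v))"
    by (intro continuous_on_dotp continuous_on_subset[OF assms(1)]) auto
  ultimately obtain m where m: "m \<in> S" "\<And>v. v \<in> S \<Longrightarrow> dotp n (T v) (T v) \<le> dotp n (T m) (T m)"
    using continuous_attains_sup[of S "\<lambda>v. dotp n (T v) (T v)"] by auto
  define w where "w = u(k := m)"
  have mS: "m \<in> Rn n" "dotp n m m = 1" "\<And>j. j < k \<Longrightarrow> dotp n m (u j) = 0"
    using m(1) by (auto simp: S_def unit_ball_def)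
  have "orthonormal n (Suc k) w"
    unfolding orthonormal_def
  proof (intro conjI allI impI)
    fix i j assume "i < Suc k" "j < Suc k"
    then consider "i < k" "j < k" | "i < k" "j = k" | "i = k" "j < k" | "i = k" "j = k"
      by linarith
    then show "dotp n (w i) (w j) = (if i = j then 1 else 0)"
      using u mS(2,3) dotp_commute[of n "u i" m] by cases (auto simp: w_def orthonormal_def)
  next
    fix i assume "i < Suc k"
    then show "w i \<in> Rn n" using u mS(1) by (auto simp: w_def orthonormal_def less_Suc_eq)
  qed
  moreover have "dotp n (T v) (T v) \<le> dotp n (T (w i)) (T (w i)) * dotp n v v"
    if "i < Suc k" "v \<in> Rn n" "\<forall>j<i. dotp n v (w j) = 0" for i v
  proof (cases "i < k")
    case True
    then show ?thesis using mx[OF True that(2)] that(3) by (auto simp: w_def)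
  next
    case False
    then have "i = k" using that(1) by simp
    then have perp: "\<And>j. j < k \<Longrightarrow> dotp n v (u j) = 0" using that(3) by (auto simp: w_def)
    \<comment> \<open>Only a nonzero v can be scaled into \<open>S\<close>; for v = 0 both sides are
      0.\<close>
    show ?thesis
    proof (cases "dotp n v v = 0")
      case True
      then have "v = (\<lambda>t. 0 * v t)"
        using that(2) by (auto simp: dotp_self_eq_0_iff Rn_def) (metis not_le)
      then have "T v = (\<lambda>t. 0)" using T0 by metis
      then show ?thesis by (simp add: True) (simp add: dotp_def)
    next
      case False
      define s where "s = 1 / sqrt (dotp n v v)"
      have pos: "dotp n v v > 0" using False dotp_self_nonneg[of n v] by simp
      then have s2: "s * s * dotp n v v = 1" by (simp add: s_def field_simps)
      have "(\<lambda>t. s * v t) \<in> S"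
        using that(2) s2 perp by (auto simp: S_def unit_ball_def enorm_eq Rn_def dotp_bilinear)
      from m(2)[OF this] have "s * s * dotp n (T v) (T v) \<le> dotp n (T m) (T m)"
        by (simp add: Tscale dotp_bilinear)
      then have "s * s * dotp n (T v) (T v) * dotp n v v \<le> dotp n (T m) (T m) * dotp n v v"
        using pos by (simp add: mult_right_mono)
      then have "dotp n (T v) (T v) * (s * s * dotp n v v) \<le> dotp n (T m) (T m) * dotp n v v"
        by (simp add: mult_ac)
      then show ?thesis using s2 \<open>i = k\<close> by (simp add: w_def)
    qed
  qed
  ultimately show ?case by blast
qed

lemma linear_le_quadratic_imp_zero:
  fixes b q :: real
  assumes "\<And>s. 2 * s * b \<le> s\<^sup>2 * q"
  shows "b = 0"
proof (rule ccontr)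
  assume "b \<noteq> 0"
  \<comment> \<open>This s has the sign of b, and the denominator is positive even for q = 0. It
    makes the quadratic term at most \<open>s * b\<close>, half of the linear one.\<close>
  define s where "s = b / (1 + \<bar>q\<bar>)"
  have "s\<^sup>2 * q \<le> s\<^sup>2 * \<bar>q\<bar>" by (simp add: mult_left_mono)
  also have "\<dots> \<le> s\<^sup>2 * (1 + \<bar>q\<bar>)" by (simp add: mult_left_mono)
  also have "\<dots> = s * b"
  proof -
    have "s * (1 + \<bar>q\<bar>) = b" unfolding s_def by (simp add: add_pos_nonneg)
    then show ?thesis by (simp add: power2_eq_square mult.assoc)
  qed
  finally have "s * b \<le> 0" using assms[of s] by simp
  moreover have "s * b > 0"
    using \<open>b \<noteq> 0\<close> by (simp add: s_def zero_less_divide_iff add_pos_nonneg)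
      (metis not_real_square_gt_zero)
  ultimately show False by simp
qed

text \<open>The greedy maximisers have orthogonal images; normalising these gives \<open>w\<close>,
  and their lengths are \<open>a\<close>, positive by injectivity on \<open>Rn n\<close>. Later only
  the longest axis is singled out, so the ordering is recorded as
  \<open>a i \<le> a 0\<close>.\<close>

lemma singular_value_decomposition:
  assumes "\<And>i. continuous_on UNIV (\<lambda>x. T x i)" "lin_map T"
    and "\<And>x. x \<in> Rn n \<Longrightarrow> T x \<in> Rn n"
    and "\<And>x. x \<in> Rn n \<Longrightarrow> dotp n (T x) (T x) = 0 \<Longrightarrow> dotp n x x = 0"
  shows "\<exists>u w a. orthonormal n n u \<and> orthonormal n n w \<and> (\<forall>i<n. 0 < a i \<and> a i \<le> a 0) \<and>
    (\<forall>i<n. T (u i) = (\<lambda>t. a i * w i t))"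
proof -
  obtain u where u: "orthonormal n n u"
    and "\<forall>i<n. \<forall>v\<in>Rn n. (\<forall>j<i. dotp n v (u j) = 0) \<longrightarrow>
       dotp n (T v) (T v) \<le> dotp n (T (u i)) (T (u i)) * dotp n v v"
    using ex_maximal_orthonormal[of T n n, OF assms(1,2) order_refl] by (elim exE conjE)
  then have mx: "dotp n (T v) (T v) \<le> dotp n (T (u i)) (T (u i)) * dotp n v v"
    if "i < n" "v \<in> Rn n" "\<forall>j<i. dotp n v (u j) = 0" for i v
    using that by simp
  have uR: "\<And>i. i < n \<Longrightarrow> u i \<in> Rn n"
    and uu: "\<And>i j. i < n \<Longrightarrow> j < n \<Longrightarrow> dotp n (u i) (u j) = (if i = j then 1 else 0)"
    using u by (auto simp: orthonormal_def)
  \<comment> \<open>First variation: \<open>u i + s * u j\<close> is still orthogonal to the earlier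
    vectors, so maximality of \<open>u i\<close> holds for all s and forces the term linear in s to
    vanish.\<close>
  have perp: "dotp n (T (u i)) (T (u j)) = 0" if "i < j" "j < n" for i j
  proof (rule linear_le_quadratic_imp_zero)
    fix s :: real
    let ?v = "\<lambda>t. u i t + s * u j t"
    have "?v \<in> Rn n" using uR[of i] uR[of j] that by (auto simp: Rn_def)
    moreover have "\<forall>l<i. dotp n ?v (u l) = 0" using that by (auto simp: dotp_bilinear uu)
    ultimately have le: "dotp n (T ?v) (T ?v) \<le> dotp n (T (u i)) (T (u i)) * dotp n ?v ?v"
      using mx that by simp
    have Tv: "T ?v = (\<lambda>t. T (u i) t + s * T (u j) t)"
      by (rule lin_mapD[OF assms(2)])
    have "dotp n ?v ?v = 1 + s * s"
      using that by (simp add: dotp_bilinear uu)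
    then show "2 * s * dotp n (T (u i)) (T (u j)) \<le>
        s\<^sup>2 * (dotp n (T (u i)) (T (u i)) - dotp n (T (u j)) (T (u j)))"
      using le unfolding Tv
      by (simp add: dotp_bilinear dotp_commute[of n "T (u j)" "T (u i)"] algebra_simps power2_eq_square)
  qed
  define a where "a i = sqrt (dotp n (T (u i)) (T (u i)))" for i
  define w where "w i = (\<lambda>t. (1 / a i) * T (u i) t)" for i
  have Tpos: "dotp n (T (u i)) (T (u i)) > 0" if "i < n" for i
    using assms(4)[OF uR[OF that]] uu[OF that that] dotp_self_nonneg[of n "T (u i)"]
    by (cases "dotp n (T (u i)) (T (u i)) = 0") auto
  have apos: "a i > 0" if "i < n" for i using Tpos[OF that] by (simp add: a_def)
  have a2: "a i * a i = dotp n (T (u i)) (T (u i))" if "i < n" for i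
    using Tpos[OF that] by (simp add: a_def)
  have amax: "a i \<le> a 0" if "i < n" for i
    using mx[of 0 "u i"] that uR uu by (simp add: a_def)
  have "dotp n (w i) (w j) = (if i = j then 1 else 0)" if "i < n" "j < n" for i j
  proof (cases "i = j")
    case True
    then show ?thesis using apos[OF that(1)]
      by (simp only: w_def dotp_scale_left dotp_scale_right a2[OF that(2), symmetric]) simp
  next
    case False
    then have "dotp n (T (u i)) (T (u j)) = 0"
      using perp[of i j] perp[of j i] that by (auto simp: dotp_commute neq_iff)
    then show ?thesis using False by (simp only: w_def dotp_scale_left dotp_scale_right) simp
  qed
  moreover have "w i \<in> Rn n" if "i < n" for i
    using assms(3)[OF uR[OF that]] by (auto simp: w_def Rn_def)
  ultimately have "orthonormal n n w" by (simp add: orthonormal_def)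
  moreover have "T (u i) = (\<lambda>t. a i * w i t)" if "i < n" for i
    using apos[OF that] by (simp add: w_def)
  ultimately show ?thesis using u apos amax by blast
qed

section \<open>Packing versus convex separation for a diagonal ellipsoid\<close>

text \<open>Each functional \<open>\<theta>\<close> has norm at most 3, so it certifies a distance of at least
  \<open>1/96 > 1/100\<close> from y j to the convex hull of the earlier points.\<close>

definition conv_separated :: "nat \<Rightarrow> (nat \<Rightarrow> real) \<Rightarrow> nat \<Rightarrow> (nat \<Rightarrow> nat \<Rightarrow> real) \<Rightarrow> bool" where
  "conv_separated n a M y \<longleftrightarrow>
     (\<forall>j<M. y j \<in> Rn n \<and> (\<Sum>k<n. (y j k / a k)\<^sup>2) \<le> 1 \<and>
        (\<exists>\<theta>. (\<Sum>k<n. (\<theta> k)\<^sup>2) \<le> 9 \<and>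
           (\<forall>i<j. (\<Sum>k<n. \<theta> k * y i k) + 1/32 \<le> (\<Sum>k<n. \<theta> k * y j k))))"

section \<open>Lower bound: constructing convexly separated families\<close>

lemma sum_lessThan_split_first:
  fixes g :: "nat \<Rightarrow> real"
  assumes "0 < n"
  shows "(\<Sum>k<n. g k) = g 0 + (\<Sum>k\<in>{1..<n}. g k)"
  using sum.atLeast_Suc_lessThan[of 0 n g] assms by (simp add: atLeast0LessThan)

text \<open>Points at spacing 1/32 on the longest axis are separated by the 0-th coordinate. In this
  way m controls the length \<open>a 0\<close>.\<close>

lemma conv_separated_segment:
  assumes "0 < n" "0 < a 0" "\<And>y M. conv_separated n a M y \<Longrightarrow> M \<le> m"
  shows "32 * a 0 \<le> real m"
proof -
  \<comment> \<open>The largest index is the floor of \<open>32 * a 0\<close>, so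
    \<open>j / 32\<close> stays within \<open>a 0\<close>. Counting index 0 adds 1, which makes M
    exceed \<open>32 * a 0\<close>.\<close>
  define M where "M = nat \<lfloor>32 * a 0\<rfloor> + 1"
  define y :: "nat \<Rightarrow> nat \<Rightarrow> real" where "y j k = (if k = 0 then real j / 32 else 0)" for j k
  note split0 = sum_lessThan_split_first[OF assms(1)]
  have "conv_separated n a M y"
    unfolding conv_separated_def
  proof (intro allI impI conjI)
    fix j assume "j < M"
    then have "real j \<le> 32 * a 0"
      using assms(2) by (simp add: M_def) linarith
    then have "(real j / 32 / a 0)\<^sup>2 \<le> 1"
      using assms(2) by (intro power_le_one) (auto simp: field_simps)
    then show "(\<Sum>k<n. (y j k / a k)\<^sup>2) \<le> 1" unfolding split0 by (simp add: y_def)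
    show "y j \<in> Rn n" using assms(1) by (auto simp: y_def Rn_def)
    show "\<exists>\<theta>. (\<Sum>k<n. (\<theta> k)\<^sup>2) \<le> 9 \<and>
           (\<forall>i<j. (\<Sum>k<n. \<theta> k * y i k) + 1/32 \<le> (\<Sum>k<n. \<theta> k * y j k))"
      by (rule exI[of _ "\<lambda>k. if k = 0 then 1 else 0"]) (auto simp: split0 y_def)
  qed
  from assms(3)[OF this] show ?thesis unfolding M_def by linarith
qed

lemma sum_sq_le_weighted:
  fixes a z :: "nat \<Rightarrow> real"
  assumes "\<And>i. i \<in> I \<Longrightarrow> 0 < a i \<and> a i \<le> A" "0 < A" "(\<Sum>i\<in>I. (z i)\<^sup>2 / a i) \<le> 1"
  shows "(\<Sum>i\<in>I. (z i)\<^sup>2) \<le> A"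
proof -
  have "(\<Sum>i\<in>I. (z i)\<^sup>2) \<le> (\<Sum>i\<in>I. A * ((z i)\<^sup>2 / a i))"
  proof (rule sum_mono)
    fix i assume "i \<in> I"
    then have a: "0 < a i" "a i \<le> A" using assms(1) by auto
    have "(z i)\<^sup>2 = a i * ((z i)\<^sup>2 / a i)" using a by simp
    also have "\<dots> \<le> A * ((z i)\<^sup>2 / a i)" using a by (intro mult_right_mono) auto
    finally show "(z i)\<^sup>2 \<le> A * ((z i)\<^sup>2 / a i)" .
  qed
  also have "\<dots> \<le> A" using assms(2,3) 
    by (simp del: times_divide_eq_right add: sum_distrib_left[symmetric])
  finally show ?thesis .
qed

text \<open>The tangent functional \<open>\<theta>\<close> at a lifted point exceeds its value at any other lifted point by half
  the squared distance of the z's.\<close>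

lemma separated_card_le_conv_separated:
  fixes a :: "nat \<Rightarrow> real"
  assumes "0 < n" "\<And>i. i < n \<Longrightarrow> 0 < a i \<and> a i \<le> a 0"
    and m: "\<And>y M. conv_separated n a M y \<Longrightarrow> M \<le> m"
    and "finite Z"
    and Zin: "\<And>z. z \<in> Z \<Longrightarrow> (\<Sum>i\<in>{1..<n}. (z i)\<^sup>2 / a i) \<le> 1"
    and Zsep: "\<And>z z'. z \<in> Z \<Longrightarrow> z' \<in> Z \<Longrightarrow> z \<noteq> z' \<Longrightarrow> 1/16 \<le> (\<Sum>i\<in>{1..<n}. (z i - z' i)\<^sup>2)"
  shows "card Z \<le> m"
proof -
  note split0 = sum_lessThan_split_first[OF assms(1)]
  obtain e where e: "bij_betw e {..<card Z} Z"
    using ex_bij_betw_nat_finite[OF \<open>finite Z\<close>] by (auto simp: atLeast0LessThan)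
  have eZ: "e j \<in> Z" if "j < card Z" for j using e that by (auto simp: bij_betw_def)
  \<comment> \<open>The halves keep the lifted points inside the ellipsoid: the 0-th coordinate and
    the remaining ones each contribute at most 1/4.\<close>
  define y where "y j k = (if k = 0 then (\<Sum>i\<in>{1..<n}. (e j i)\<^sup>2) / 2
      else if k < n then sqrt (a k) * e j k / 2 else 0)" for j k
  have a0: "0 < a 0" using assms(1,2) by auto
  have pos: "0 < a k" if "k \<in> {1..<n}" for k using assms(2) that by auto
  have "conv_separated n a (card Z) y"
    unfolding conv_separated_def
  proof (intro allI impI conjI)
    fix j assume j: "j < card Z"
    let ?z = "e j"
    let ?s = "\<Sum>i\<in>{1..<n}. (?z i)\<^sup>2"
    show "y j \<in> Rn n" using assms(1) by (auto simp: y_def Rn_def)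
    have s: "?s \<le> a 0"
      by (rule sum_sq_le_weighted[where a = a]) (use assms(2) a0 Zin[OF eZ[OF j]] in auto)
    have "(y j 0 / a 0)\<^sup>2 \<le> (1/2)\<^sup>2"
      using s a0 by (intro power_mono) (auto simp: y_def field_simps sum_nonneg)
    then have "(y j 0 / a 0)\<^sup>2 \<le> 1/4" by (simp add: power2_eq_square)
    moreover have "(\<Sum>k\<in>{1..<n}. (y j k / a k)\<^sup>2) = (\<Sum>k\<in>{1..<n}. (?z k)\<^sup>2 / a k) / 4"
      unfolding sum_divide_distrib
    proof (rule sum.cong)
      fix k assume "k \<in> {1..<n}"
      then show "(y j k / a k)\<^sup>2 = (?z k)\<^sup>2 / a k / 4"
        using pos[of k] by (simp add: y_def power_mult_distrib power_divide) (simp add: field_simps power2_eq_square)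
    qed simp
    ultimately show "(\<Sum>k<n. (y j k / a k)\<^sup>2) \<le> 1"
      using Zin[OF eZ[OF j]] unfolding split0 by linarith
    \<comment> \<open>Along the lifted points the 0-th coordinate is the sum of
      \<open>2 * y k * y k / a k\<close>. The gradient of this sum at \<open>y j\<close>, with -1
      put in front, is the normal used here; its squared norm is at most 1 + 4 \<le> 9.\<close>
    define \<theta> where "\<theta> k = (if k = 0 then -1 else 2 * ?z k / sqrt (a k))" for k
    have "(\<Sum>k\<in>{1..<n}. (\<theta> k)\<^sup>2) = (\<Sum>k\<in>{1..<n}. 4 * ((?z k)\<^sup>2 / a k))"
    proof (rule sum.cong)
      fix k assume "k \<in> {1..<n}"
      then show "(\<theta> k)\<^sup>2 = 4 * ((?z k)\<^sup>2 / a k)"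
        using pos[of k] by (simp add: \<theta>_def power_mult_distrib power_divide)
    qed simp
    then have "(\<Sum>k<n. (\<theta> k)\<^sup>2) \<le> 9"
      using Zin[OF eZ[OF j]] unfolding split0
      by (simp del: times_divide_eq_right add: sum_distrib_left[symmetric]) (simp add: \<theta>_def)
    moreover have "(\<Sum>k<n. \<theta> k * y i k) + 1/32 \<le> (\<Sum>k<n. \<theta> k * y j k)" if "i < j" for i
    proof -
      have val: "(\<Sum>k<n. \<theta> k * y l k) =
          - (\<Sum>k\<in>{1..<n}. (e l k)\<^sup>2) / 2 + (\<Sum>k\<in>{1..<n}. ?z k * e l k)" for l
      proof -
        have "(\<Sum>k\<in>{1..<n}. \<theta> k * y l k) = (\<Sum>k\<in>{1..<n}. ?z k * e l k)"
        proof (rule sum.cong)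
          fix k assume "k \<in> {1..<n}"
          then show "\<theta> k * y l k = ?z k * e l k"
            using pos[of k] by (simp add: \<theta>_def y_def)
        qed simp
        then show ?thesis unfolding split0 by (simp add: \<theta>_def y_def)
      qed
      have "e i \<noteq> ?z" using e j that by (auto simp: bij_betw_def inj_on_def)
      then have "1/16 \<le> (\<Sum>k\<in>{1..<n}. (?z k - e i k)\<^sup>2)"
        using Zsep[OF eZ[OF j] eZ] j that by auto
      also have "\<dots> = (\<Sum>k\<in>{1..<n}. (?z k)\<^sup>2) - 2 * (\<Sum>k\<in>{1..<n}. ?z k * e i k)
          + (\<Sum>k\<in>{1..<n}. (e i k)\<^sup>2)"
        by (simp add: power2_diff sum.distrib sum_subtractf sum_distrib_left mult.assoc algebra_simps)
      finally show ?thesis unfolding val by (simp add: power2_eq_square)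
    qed
    ultimately show "\<exists>\<theta>. (\<Sum>k<n. (\<theta> k)\<^sup>2) \<le> 9 \<and>
           (\<forall>i<j. (\<Sum>k<n. \<theta> k * y i k) + 1/32 \<le> (\<Sum>k<n. \<theta> k * y j k))"
      by blast
  qed
  then show ?thesis by (rule m)
qed

section \<open>Upper bound: covering and the packing estimate\<close>

text \<open>A covering of F, stated as a labelling so that pairs of labels can be counted. The label
  of z consists of a net point near its section part and the cell of length 1/2 containing
  \<open>z 0\<close>. Each component takes at most m values.\<close>

lemma sqrt_ellipsoid_labelling:
  fixes a :: "nat \<Rightarrow> real"
  assumes "0 < n" and a: "\<forall>i<n. 0 < a i \<and> a i \<le> a 0" and "1 \<le> a 0"
    and "\<forall>M y. conv_separated n a M y \<longrightarrow> M \<le> m"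
  shows "\<exists>(\<Lambda> :: ((nat \<Rightarrow> real) \<times> int) set) l. finite \<Lambda> \<and> card \<Lambda> \<le> m\<^sup>2 \<and>
    (\<forall>z. (\<Sum>i<n. (z i)\<^sup>2 / a i) \<le> 1 \<longrightarrow> l z \<in> \<Lambda>) \<and>
    (\<forall>z z'. (\<Sum>i<n. (z i)\<^sup>2 / a i) \<le> 1 \<longrightarrow> (\<Sum>i<n. (z' i)\<^sup>2 / a i) \<le> 1 \<longrightarrow> l z = l z' \<longrightarrow>
       (\<Sum>i<n. (z i - z' i)\<^sup>2) < 1)"
proof -
  have apos: "0 < a i \<and> a i \<le> a 0" if "i < n" for i using a that by blast
  have m: "M \<le> m" if "conv_separated n a M y" for M y using assms(4) that by blast
  note split0 = sum_lessThan_split_first[OF assms(1)]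
  define P where "P Z \<longleftrightarrow> finite Z \<and> (\<forall>z\<in>Z. (\<Sum>i\<in>{1..<n}. (z i)\<^sup>2 / a i) \<le> 1) \<and>
     (\<forall>z\<in>Z. \<forall>z'\<in>Z. z \<noteq> z' \<longrightarrow> 1/16 \<le> (\<Sum>i\<in>{1..<n}. (z i - z' i)\<^sup>2))" for Z :: "(nat \<Rightarrow> real) set"
  have bound: "card Z \<le> m" if "P Z" for Z
    by (rule separated_card_le_conv_separated[of n a m Z, OF assms(1) apos m])
      (use that in \<open>auto simp: P_def\<close>)
  have "P {}" by (simp add: P_def)
  then obtain Z where Z: "P Z" and Zmax: "\<And>Y. P Y \<Longrightarrow> card Y \<le> card Z"
    using ex_has_greatest_nat[of P "{}" card "Suc m"] bound by (auto simp: less_Suc_eq_le)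
  \<comment> \<open>A separated family of largest size, which exists because sizes are at most m, is
    a net: a point far from all of \<open>Z\<close> could be added.\<close>
  have near: "\<exists>y\<in>Z. (\<Sum>i\<in>{1..<n}. (z i - y i)\<^sup>2) < 1/16"
    if z: "(\<Sum>i\<in>{1..<n}. (z i)\<^sup>2 / a i) \<le> 1" for z
  proof (rule ccontr)
    assume "\<not> ?thesis"
    then have far: "\<And>y. y \<in> Z \<Longrightarrow> 1/16 \<le> (\<Sum>i\<in>{1..<n}. (z i - y i)\<^sup>2)" by force
    then have "z \<notin> Z" by force
    have "1/16 \<le> (\<Sum>i\<in>{1..<n}. (y i - z i)\<^sup>2)" if "y \<in> Z" for y
      using far[OF that] by (simp add: power2_commute)
    then have "P (insert z Z)" using Z z far by (auto simp: P_def)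
    from Zmax[OF this] show False using Z \<open>z \<notin> Z\<close> by (simp add: P_def)
  qed
  define c where "c z = (SOME y. y \<in> Z \<and> (\<Sum>i\<in>{1..<n}. (z i - y i)\<^sup>2) < 1/16)" for z
  have c: "c z \<in> Z \<and> (\<Sum>i\<in>{1..<n}. (z i - c z i)\<^sup>2) < 1/16"
    if "(\<Sum>i\<in>{1..<n}. (z i)\<^sup>2 / a i) \<le> 1" for z
  proof -
    from near[OF that] have "\<exists>y. y \<in> Z \<and> (\<Sum>i\<in>{1..<n}. (z i - y i)\<^sup>2) < 1/16" by blast
    from someI_ex[OF this] show ?thesis unfolding c_def .
  qed
  \<comment> \<open>The cells for 0-th coordinates in \<open>[-a 0, a 0]\<close>. There are at most
    \<open>4 * a 0 + 2\<close>, which \<open>1 \<le> a 0\<close> and the equidistant points on the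
    longest axis bound by m.\<close>
  define J where "J = {\<lfloor>- 2 * a 0\<rfloor> .. \<lfloor>2 * a 0\<rfloor>}"
  define l where "l z = (c z, \<lfloor>2 * z 0\<rfloor>)" for z :: "nat \<Rightarrow> real"
  have "real (card J) \<le> 4 * a 0 + 2"
    using assms(3) unfolding J_def by simp linarith
  also have "\<dots> \<le> 32 * a 0" using assms(3) by simp
  also have "\<dots> \<le> real m" using assms(1,3) by (intro conv_separated_segment m) auto
  finally have "card J \<le> m" by simp
  then have card: "card (Z \<times> J) \<le> m\<^sup>2"
    using bound[OF Z] by (simp add: card_cartesian_product power2_eq_square mult_le_mono)
  have tail: "(\<Sum>i\<in>{1..<n}. (z i)\<^sup>2 / a i) \<le> 1" and head: "\<bar>z 0\<bar> \<le> a 0"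
    if z: "(\<Sum>i<n. (z i)\<^sup>2 / a i) \<le> 1" for z
  proof -
    have h: "0 \<le> (z 0)\<^sup>2 / a 0" using assms(3) by simp
    have t: "0 \<le> (\<Sum>i\<in>{1..<n}. (z i)\<^sup>2 / a i)"
    proof (rule sum_nonneg)
      fix i assume "i \<in> {1..<n}" then show "0 \<le> (z i)\<^sup>2 / a i" using apos[of i] by auto
    qed
    show "(\<Sum>i\<in>{1..<n}. (z i)\<^sup>2 / a i) \<le> 1" using z h unfolding split0 by simp
    have "(z 0)\<^sup>2 / a 0 \<le> 1" using z t unfolding split0 by simp
    then have "(z 0)\<^sup>2 \<le> a 0" using assms(3) by (simp add: field_simps)
    \<comment> \<open>The true bound on \<open>z 0\<close> is \<open>sqrt (a 0)\<close>. Since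
      \<open>1 \<le> a 0\<close> it may be weakened to \<open>a 0\<close>, the range that
      \<open>J\<close> covers.\<close>
    also have "\<dots> \<le> (a 0)\<^sup>2" using assms(3) by (simp add: power2_eq_square)
    finally show "\<bar>z 0\<bar> \<le> a 0" using assms(3) abs_le_square_iff[of "z 0" "a 0"] by simp
  qed
  have "l z \<in> Z \<times> J" if "(\<Sum>i<n. (z i)\<^sup>2 / a i) \<le> 1" for z
    using c[OF tail[OF that]] head[OF that] by (auto simp: l_def J_def abs_le_iff intro!: floor_mono)
  moreover have "(\<Sum>i<n. (z i - z' i)\<^sup>2) < 1"
    if z: "(\<Sum>i<n. (z i)\<^sup>2 / a i) \<le> 1" and z': "(\<Sum>i<n. (z' i)\<^sup>2 / a i) \<le> 1" and eq: "l z = l z'" for z z'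
  proof -
    have "\<lfloor>2 * z 0\<rfloor> = \<lfloor>2 * z' 0\<rfloor>" using eq by (simp add: l_def)
    then have "\<bar>z 0 - z' 0\<bar> \<le> 1/2" by linarith
    then have "\<bar>z 0 - z' 0\<bar>\<^sup>2 \<le> (1/2)\<^sup>2" by (intro power_mono) auto
    then have h: "(z 0 - z' 0)\<^sup>2 \<le> 1/4" by (simp add: power2_eq_square)
    \<comment> \<open>Both points are within squared distance 1/16 of the same net point, so theirs
      is below 2/16 + 2/16 = 1/4. With at most 1/4 from the 0-th coordinate the total stays below
      1.\<close>
    have "(\<Sum>i\<in>{1..<n}. (z i - z' i)\<^sup>2) \<le>
        (\<Sum>i\<in>{1..<n}. 2 * (z i - c z i)\<^sup>2 + 2 * (z' i - c z i)\<^sup>2)"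
    proof (rule sum_mono)
      fix i
      have "0 \<le> ((z i - c z i) + (z' i - c z i))\<^sup>2" by simp
      then show "(z i - z' i)\<^sup>2 \<le> 2 * (z i - c z i)\<^sup>2 + 2 * (z' i - c z i)\<^sup>2"
        by (simp add: power2_eq_square algebra_simps)
    qed
    also have "\<dots> = 2 * (\<Sum>i\<in>{1..<n}. (z i - c z i)\<^sup>2) + 2 * (\<Sum>i\<in>{1..<n}. (z' i - c z' i)\<^sup>2)"
      using eq by (simp add: sum.distrib sum_distrib_left l_def)
    also have "\<dots> < 1/4" using c[OF tail[OF z]] c[OF tail[OF z']] by simp
    finally show ?thesis using h unfolding split0 by simp
  qed
  ultimately show ?thesis
    using card Z by (intro exI[of _ "Z \<times> J"] exI[of _ l]) (auto simp: P_def J_def)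
qed

text \<open>Two rounds of labelling, realising N(E, ball) \<le> N(F, ball)^2: first
  \<open>z i\<close>, the preimage of \<open>x i\<close> under D = diag (sqrt a), then the remainder
  \<open>y i\<close> after subtracting D times a representative of the first label. Points sharing
  both labels are closer than the packing permits, so the at most \<open>m ^ 4\<close> pairs bound
  N.\<close>

lemma packing_le_conv_separated:
  fixes a :: "nat \<Rightarrow> real"
  assumes apos: "\<And>i. i < n \<Longrightarrow> 0 < a i \<and> a i \<le> a 0"
    and m: "\<And>y M. conv_separated n a M y \<Longrightarrow> M \<le> m"
    and X: "\<And>i. i < N \<Longrightarrow> (\<Sum>k<n. (x i k / a k)\<^sup>2) \<le> 1"
    and sep: "\<And>i j. i < N \<Longrightarrow> j < N \<Longrightarrow> i \<noteq> j \<Longrightarrow> 4 \<le> (\<Sum>k<n. (x i k - x j k)\<^sup>2)"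
  shows "N \<le> m ^ 4"
proof (cases "0 < n \<and> 1 \<le> a 0")
  case True
  then have n0: "0 < n" and a1: "1 \<le> a 0" by auto
  have aa: "\<forall>i<n. 0 < a i \<and> a i \<le> a 0" and mm: "\<forall>M y. conv_separated n a M y \<longrightarrow> M \<le> m"
    using apos m by auto
  obtain \<Lambda> :: "((nat \<Rightarrow> real) \<times> int) set" and l where fin: "finite \<Lambda>" and card: "card \<Lambda> \<le> m\<^sup>2"
    and l': "\<forall>z. (\<Sum>i<n. (z i)\<^sup>2 / a i) \<le> 1 \<longrightarrow> l z \<in> \<Lambda>"
    and close': "\<forall>z z'. (\<Sum>i<n. (z i)\<^sup>2 / a i) \<le> 1 \<longrightarrow> (\<Sum>i<n. (z' i)\<^sup>2 / a i) \<le> 1 \<longrightarrow> l z = l z' \<longrightarrow>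
       (\<Sum>i<n. (z i - z' i)\<^sup>2) < 1"
    using sqrt_ellipsoid_labelling[OF n0 aa a1 mm] by (elim exE conjE)
  have l: "l z \<in> \<Lambda>" if "(\<Sum>i<n. (z i)\<^sup>2 / a i) \<le> 1" for z
    using l' that by simp
  have close: "(\<Sum>i<n. (z i - z' i)\<^sup>2) < 1"
    if "(\<Sum>i<n. (z i)\<^sup>2 / a i) \<le> 1" "(\<Sum>i<n. (z' i)\<^sup>2 / a i) \<le> 1" "l z = l z'" for z z'
    using close' that by simp
  define z where "z i k = x i k / sqrt (a k)" for i k
  \<comment> \<open>The representative depends on the label alone, so it cancels in
    \<open>y i - y j\<close> when the first labels agree.\<close>
  define r where "r p = (SOME w. (\<Sum>k<n. (w k)\<^sup>2 / a k) \<le> 1 \<and> l w = p)" for p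
  define y where "y i k = x i k - sqrt (a k) * r (l (z i)) k" for i k
  have z: "(\<Sum>k<n. (z i k)\<^sup>2 / a k) \<le> 1" if "i < N" for i
  proof -
    have "(\<Sum>k<n. (z i k)\<^sup>2 / a k) = (\<Sum>k<n. (x i k / a k)\<^sup>2)"
    proof (rule sum.cong)
      fix k assume "k \<in> {..<n}"
      then have "0 < a k" using apos by auto
      then show "(z i k)\<^sup>2 / a k = (x i k / a k)\<^sup>2"
        by (simp add: z_def power_divide) (simp add: power2_eq_square)
    qed simp
    then show ?thesis using X[OF that] by simp
  qed
  have r: "(\<Sum>k<n. (r (l (z i)) k)\<^sup>2 / a k) \<le> 1 \<and> l (r (l (z i))) = l (z i)" if "i < N" for i
  proof -
    from z[OF that] have "\<exists>w. (\<Sum>k<n. (w k)\<^sup>2 / a k) \<le> 1 \<and> l w = l (z i)" by blast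
    from someI_ex[OF this] show ?thesis unfolding r_def .
  qed
  \<comment> \<open>\<open>y i\<close> is D applied to a vector of norm below 1, hence a point of F
    again, and the same labelling serves the second round.\<close>
  have y: "(\<Sum>k<n. (y i k)\<^sup>2 / a k) \<le> 1" if "i < N" for i
  proof -
    have "(\<Sum>k<n. (y i k)\<^sup>2 / a k) = (\<Sum>k<n. (z i k - r (l (z i)) k)\<^sup>2)"
    proof (rule sum.cong)
      fix k assume "k \<in> {..<n}"
      then have "0 < a k" using apos by auto
      then have "y i k = sqrt (a k) * (z i k - r (l (z i)) k)"
        by (simp add: y_def z_def algebra_simps)
      then show "(y i k)\<^sup>2 / a k = (z i k - r (l (z i)) k)\<^sup>2"
        using \<open>0 < a k\<close> by (simp add: power_mult_distrib)
    qed simp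
    also have "\<dots> < 1" using r[OF that] z[OF that] by (intro close) auto
    finally show ?thesis by simp
  qed
  have "inj_on (\<lambda>i. (l (z i), l (y i))) {..<N}"
  proof (rule inj_onI)
    fix i j assume ij: "i \<in> {..<N}" "j \<in> {..<N}" and eq: "(l (z i), l (y i)) = (l (z j), l (y j))"
    show "i = j"
    proof (rule ccontr)
      assume "i \<noteq> j"
      have "(\<Sum>k<n. (y i k - y j k)\<^sup>2) < 1" using y ij eq by (intro close) auto
      moreover have "y i k - y j k = x i k - x j k" for k using eq by (simp add: y_def)
      ultimately show False using sep[of i j] ij \<open>i \<noteq> j\<close> by simp
    qed
  qed
  moreover have "(\<lambda>i. (l (z i), l (y i))) ` {..<N} \<subseteq> \<Lambda> \<times> \<Lambda>"
    using l z y by auto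
  ultimately have "card {..<N} \<le> card (\<Lambda> \<times> \<Lambda>)"
    using fin by (intro card_inj_on_le) auto
  also have "\<dots> \<le> m\<^sup>2 * m\<^sup>2" 
    unfolding card_cartesian_product using card by (intro mult_le_mono)
  finally show ?thesis by (simp flip: power_add)
next
  case False
  \<comment> \<open>Here n = 0 or \<open>a 0 < 1\<close>, so all points have norm below 1 and no two
    of them are at distance 2. A single point at the origin then supplies
    \<open>1 \<le> m\<close>.\<close>
  have "\<not> 1 < N"
  proof
    assume N: "1 < N"
    have norm: "(\<Sum>k<n. (x i k)\<^sup>2) < 1" if "i < N" for i
    proof (cases "n = 0")
      case f: False
      then have a0: "0 < a 0" "a 0 < 1" using apos[of 0] False by auto
      have "(\<Sum>k<n. (x i k)\<^sup>2) \<le> (a 0)\<^sup>2"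
      proof (rule sum_sq_le_weighted)
        show "(\<Sum>k<n. (x i k)\<^sup>2 / (a k)\<^sup>2) \<le> 1" using X[OF that] by (simp add: power_divide)
        show "0 < (a k)\<^sup>2 \<and> (a k)\<^sup>2 \<le> (a 0)\<^sup>2" if "k \<in> {..<n}" for k
          using apos[of k] that by (auto intro!: power_mono)
      qed (use a0 in simp)
      also have "\<dots> < 1" using a0 by (simp add: power_less_one_iff)
      finally show ?thesis .
    qed simp
    have "(\<Sum>k<n. (x 0 k - x 1 k)\<^sup>2) \<le> (\<Sum>k<n. 2 * (x 0 k)\<^sup>2 + 2 * (x 1 k)\<^sup>2)"
    proof (rule sum_mono)
      fix k
      have "0 \<le> (x 0 k + x 1 k)\<^sup>2" by simp
      then show "(x 0 k - x 1 k)\<^sup>2 \<le> 2 * (x 0 k)\<^sup>2 + 2 * (x 1 k)\<^sup>2"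
        by (simp add: power2_eq_square algebra_simps)
    qed
    also have "\<dots> = 2 * (\<Sum>k<n. (x 0 k)\<^sup>2) + 2 * (\<Sum>k<n. (x 1 k)\<^sup>2)"
      by (simp add: sum.distrib sum_distrib_left)
    also have "\<dots> < 4" using norm[of 0] norm[of 1] N by simp
    finally show False using sep[of 0 1] N by simp
  qed
  moreover have "1 \<le> m"
  proof (rule m)
    show "conv_separated n a 1 (\<lambda>_ _. 0)"
      by (auto simp: conv_separated_def Rn_def intro!: exI[of _ "\<lambda>_. 0"])
  qed
  ultimately show ?thesis by (metis not_le one_le_power order_trans)
qed

section \<open>Passage to general ellipsoids\<close>

lemma mat_app_in_Rn: "mat_app n A x \<in> Rn n"
  by (simp add: mat_app_def Rn_def)

lemma mat_app_eq_dotp: "i < n \<Longrightarrow> mat_app n A x i = dotp n (A i) x"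
  by (simp add: mat_app_def dotp_def)

lemma lin_map_mat_app: "lin_map (mat_app n A)"
  by (auto simp: lin_map_def mat_app_def fun_eq_iff distrib_left sum.distrib sum_distrib_left mult_ac)

lemma lin_map_sum:
  assumes "lin_map T"
  shows "T (\<lambda>t. \<Sum>i<(k::nat). c i * u i t) = (\<lambda>t. \<Sum>i<k. c i * T (u i) t)"
proof (induction k)
  case 0
  have "T (\<lambda>t. 0 + (-1) * 0) = (\<lambda>t. T (\<lambda>t. 0) t + (-1) * T (\<lambda>t. 0) t)"
    by (rule lin_mapD[OF assms])
  then show ?case by simp
next
  case (Suc k)
  then show ?case by (simp add: lin_mapD[OF assms])
qed

lemma continuous_on_mat_app:
  assumes "\<And>i. continuous_on S (\<lambda>x. f x i)"
  shows "continuous_on S (\<lambda>x. mat_app n A (f x) i)"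
  by (cases "i < n") (auto simp: mat_app_def intro!: continuous_intros assms)

text \<open>Singular values of \<open>T = G A\<close>, where G inverts the map defining B. The
  functionals \<open>dotp n (g k)\<close> serve as coordinates in which B is the unit ball and E is
  diagonal with semi-axes \<open>a\<close>.\<close>

lemma ellipsoid_pair_coordinates:
  assumes "ellipsoid n E" "ellipsoid n B"
  shows "\<exists>a g. (\<forall>i<n. 0 < a i \<and> a i \<le> a 0) \<and>
    (\<forall>x\<in>E. x \<in> Rn n \<and> (\<Sum>k<n. (dotp n (g k) x / a k)\<^sup>2) \<le> 1) \<and>
    (\<forall>t. (\<Sum>k<n. (t k / a k)\<^sup>2) \<le> 1 \<longrightarrow> (\<exists>x\<in>E. \<forall>k<n. dotp n (g k) x = t k)) \<and>
    B = {y \<in> Rn n. (\<Sum>k<n. (dotp n (g k) y)\<^sup>2) \<le> 1}"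
proof -
  obtain A A' where E: "E = mat_app n A ` unit_ball n"
    and A: "\<And>x. x \<in> Rn n \<Longrightarrow> mat_app n A' (mat_app n A x) = x"
    using assms(1) unfolding ellipsoid_def invertible_mat_def by blast
  obtain F G where B: "B = mat_app n F ` unit_ball n"
    and F: "\<And>x. x \<in> Rn n \<Longrightarrow> mat_app n G (mat_app n F x) = x"
      "\<And>x. x \<in> Rn n \<Longrightarrow> mat_app n F (mat_app n G x) = x"
    using assms(2) unfolding ellipsoid_def invertible_mat_def by blast
  define T where "T x = mat_app n G (mat_app n A x)" for x
  have zero: "mat_app n M (\<lambda>_. 0) = (\<lambda>_. 0)" for M by (simp add: mat_app_def fun_eq_iff)
  have lin: "lin_map T"
    unfolding lin_map_def T_def lin_mapD[OF lin_map_mat_app] by blast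
  have inj: "dotp n x x = 0" if "x \<in> Rn n" "dotp n (T x) (T x) = 0" for x
  proof -
    have "T x i = 0" for i
      using that(2) by (cases "i < n") (auto simp: dotp_self_eq_0_iff T_def mat_app_def)
    then have "T x = (\<lambda>_. 0)" by auto
    \<comment> \<open>F cancels G and then \<open>A'\<close> cancels A, so this composition recovers
      x.\<close>
    then have "mat_app n A' (mat_app n F (T x)) = (\<lambda>_. 0)" by (simp add: zero)
    then have "x = (\<lambda>_. 0)" by (simp add: T_def F mat_app_in_Rn A that(1))
    then show ?thesis by (simp add: dotp_def)
  qed
  have TR: "T x \<in> Rn n" for x by (simp add: T_def mat_app_in_Rn)
  have cont: "continuous_on UNIV (\<lambda>x. T x i)" for i
    unfolding T_def by (intro continuous_on_mat_app continuous_on_coord)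
  have svd: "\<exists>u w a. orthonormal n n u \<and> orthonormal n n w \<and> (\<forall>i<n. 0 < a i \<and> a i \<le> a 0) \<and>
      (\<forall>i<n. T (u i) = (\<lambda>t. a i * w i t))"
    by (rule singular_value_decomposition[OF cont lin TR]) (rule inj)
  obtain u w a where u: "orthonormal n n u" and w: "orthonormal n n w"
    and a: "\<forall>i<n. 0 < a i \<and> a i \<le> a 0" and Tu: "\<forall>i<n. T (u i) = (\<lambda>t. a i * w i t)"
    using svd by (elim exE conjE)
  \<comment> \<open>The transpose of G applied to \<open>w k\<close>, so that \<open>g k\<close>
    reads off the k-th coordinate of \<open>G y\<close> in the basis \<open>w\<close>.\<close>
  define g where "g k = (\<lambda>t. \<Sum>i<n. w k i * G i t)" for k
  have g: "dotp n (g k) y = dotp n (mat_app n G y) (w k)" for k y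
  proof -
    have "dotp n (g k) y = (\<Sum>i<n. w k i * dotp n (G i) y)"
      unfolding g_def by (rule dotp_sum_left)
    then show ?thesis by (simp add: dotp_def[of n _ "w k"] mat_app_eq_dotp mult.commute)
  qed
  have gA: "dotp n (g k) (mat_app n A p) = a k * dotp n p (u k)" if p: "p \<in> Rn n" and k: "k < n" for p k
  proof -
    have "p = (\<lambda>t. \<Sum>i<n. dotp n p (u i) * u i t)"
    proof
      show "p t = (\<Sum>i<n. dotp n p (u i) * u i t)" for t
        using orthonormal_expansion[OF u, of t p] p u
        by (cases "t < n") (auto simp: Rn_def orthonormal_def)
    qed
    then have "T p = T (\<lambda>t. \<Sum>i<n. dotp n p (u i) * u i t)" by (rule arg_cong)
    also have "\<dots> = (\<lambda>t. \<Sum>i<n. dotp n p (u i) * T (u i) t)" by (rule lin_map_sum[OF lin])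
    also have "\<dots> = (\<lambda>t. \<Sum>i<n. (dotp n p (u i) * a i) * w i t)" using Tu by (simp add: mult.assoc)
    finally have "T p = \<dots>" .
    then have "dotp n (T p) (w k) = dotp n p (u k) * a k"
      by (simp only: dotp_orthonormal_combination[OF w k])
    then show ?thesis unfolding g T_def by simp
  qed
  show ?thesis
  proof (rule exI[of _ a], rule exI[of _ g], intro conjI)
    show "\<forall>i<n. 0 < a i \<and> a i \<le> a 0" by (rule a)
    have "x \<in> Rn n \<and> (\<Sum>k<n. (dotp n (g k) x / a k)\<^sup>2) \<le> 1" if x: "x \<in> E" for x
    proof -
      obtain p where p: "p \<in> Rn n" "dotp n p p \<le> 1" "x = mat_app n A p"
        using x by (auto simp: E unit_ball_def enorm_eq)
      have "dotp n (g k) x / a k = dotp n p (u k)" if "k < n" for k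
        using gA[OF p(1) that] a[rule_format, OF that] by (simp add: p(3))
      then have "(\<Sum>k<n. (dotp n (g k) x / a k)\<^sup>2) = dotp n p p"
        using orthonormal_Parseval[OF u, of p] by simp
      then show ?thesis using p by (simp add: mat_app_in_Rn)
    qed
    then show "\<forall>x\<in>E. x \<in> Rn n \<and> (\<Sum>k<n. (dotp n (g k) x / a k)\<^sup>2) \<le> 1" by blast
    have "\<exists>x\<in>E. \<forall>k<n. dotp n (g k) x = t k" if "(\<Sum>k<n. (t k / a k)\<^sup>2) \<le> 1" for t
    proof -
      define p where "p = (\<lambda>s. \<Sum>i<n. (t i / a i) * u i s)"
      have pR: "p \<in> Rn n" using u by (auto simp: p_def Rn_def orthonormal_def)
      have pu: "dotp n p (u k) = t k / a k" if "k < n" for k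
        unfolding p_def by (rule dotp_orthonormal_combination[OF u that])
      have "dotp n p p = (\<Sum>k<n. (t k / a k)\<^sup>2)"
        using orthonormal_Parseval[OF u, of p] by (simp add: pu)
      then have "p \<in> unit_ball n" using that pR by (simp add: unit_ball_def enorm_eq)
      then have "mat_app n A p \<in> E" unfolding E by (rule imageI)
      moreover have "dotp n (g k) (mat_app n A p) = t k" if "k < n" for k
        using gA[OF pR that] pu[OF that] a[rule_format, OF that] by simp
      ultimately show ?thesis by blast
    qed
    then show "\<forall>t. (\<Sum>k<n. (t k / a k)\<^sup>2) \<le> 1 \<longrightarrow> (\<exists>x\<in>E. \<forall>k<n. dotp n (g k) x = t k)"
      by blast
    have Pars: "(\<Sum>k<n. (dotp n (g k) y)\<^sup>2) = dotp n (mat_app n G y) (mat_app n G y)" for y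
      unfolding g by (rule orthonormal_Parseval[OF w])
    show "B = {y \<in> Rn n. (\<Sum>k<n. (dotp n (g k) y)\<^sup>2) \<le> 1}"
    proof (intro equalityI subsetI)
      fix y assume "y \<in> B"
      then show "y \<in> {y \<in> Rn n. (\<Sum>k<n. (dotp n (g k) y)\<^sup>2) \<le> 1}"
        by (auto simp: B unit_ball_def enorm_eq Pars F mat_app_in_Rn)
    next
      fix y assume y: "y \<in> {y \<in> Rn n. (\<Sum>k<n. (dotp n (g k) y)\<^sup>2) \<le> 1}"
      then have "mat_app n G y \<in> unit_ball n" by (simp add: unit_ball_def enorm_eq Pars mat_app_in_Rn)
      moreover have "y = mat_app n F (mat_app n G y)" using y F by simp
      ultimately show "y \<in> B" unfolding B by blast
    qed
  qed
qed

section \<open>Packing and convex separation read in these coordinates\<close>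

text \<open>The gauge \<open>L\<close> of B is Lipschitz for the Euclidean norm. A value below 1 at
  q - x therefore leaves room for a whole Euclidean ball around q.\<close>

lemma in_int_transl:
  assumes B: "B = {y \<in> Rn n. (\<Sum>k<n. (dotp n (g k) y)\<^sup>2) \<le> 1}"
    and "q \<in> Rn n" "x \<in> Rn n" "(\<Sum>k<n. (dotp n (g k) (\<lambda>t. q t - x t))\<^sup>2) < 1"
  shows "q \<in> int_n n (transl x B)"
proof -
  define L where "L y = L2_set (\<lambda>k. dotp n (g k) y) {..<n}" for y
  \<comment> \<open>By Cauchy-Schwarz the sum alone bounds the square of \<open>L\<close>; the added
    1 keeps \<open>K\<close> positive in dimension 0 as well.\<close>
  define K where "K = 1 + (\<Sum>k<n. dotp n (g k) (g k))"
  have "K > 0" unfolding K_def by (intro add_pos_nonneg sum_nonneg dotp_self_nonneg) auto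
  have LK: "L y \<le> sqrt K * enorm n y" for y
  proof -
    have "(\<Sum>k<n. (dotp n (g k) y)\<^sup>2) \<le> (\<Sum>k<n. dotp n (g k) (g k) * dotp n y y)"
      by (intro sum_mono dotp_Cauchy_Schwarz)
    also have "\<dots> \<le> K * dotp n y y"
      by (simp add: K_def sum_distrib_right[symmetric] distrib_right dotp_self_nonneg)
    finally show ?thesis by (simp add: L_def L2_set_def enorm_eq flip: real_sqrt_mult)
  qed
  have Lq: "L (\<lambda>t. q t - x t) < 1" using assms(4) by (simp add: L_def L2_set_def)
  define e where "e = (1 - L (\<lambda>t. q t - x t)) / sqrt K"
  have "e > 0" using Lq \<open>K > 0\<close> by (simp add: e_def)
  moreover have "y \<in> transl x B" if y: "y \<in> Rn n" "enorm n (\<lambda>t. y t - q t) < e" for y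
  proof -
    have "(\<lambda>k. dotp n (g k) (\<lambda>t. y t - x t)) =
        (\<lambda>k. dotp n (g k) (\<lambda>t. y t - q t) + dotp n (g k) (\<lambda>t. q t - x t))"
      by (simp add: dotp_bilinear)
    then have "L (\<lambda>t. y t - x t) \<le> L (\<lambda>t. y t - q t) + L (\<lambda>t. q t - x t)"
      unfolding L_def by (simp only: L2_set_triangle_ineq)
    also have "\<dots> \<le> sqrt K * enorm n (\<lambda>t. y t - q t) + L (\<lambda>t. q t - x t)" using LK by simp
    also have "\<dots> \<le> sqrt K * e + L (\<lambda>t. q t - x t)"
      using y(2) \<open>K > 0\<close> by (simp add: mult_left_mono)
    also have "\<dots> = 1" using \<open>K > 0\<close> by (simp add: e_def)
    finally have "L (\<lambda>t. y t - x t) \<le> 1" .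
    then have "(\<lambda>t. y t - x t) \<in> B"
      using y(1) assms(3) by (auto simp: B L_def L2_set_def Rn_def)
    then show ?thesis unfolding transl_def
      by (intro image_eqI[of y _ "\<lambda>t. y t - x t"]) auto
  qed
  ultimately show ?thesis using assms(2) unfolding int_n_def by blast
qed

text \<open>If the centres were at gauge distance below 2, their midpoint would be interior to both
  translates.\<close>

lemma disjoint_translates_imp_separated:
  assumes B: "B = {y \<in> Rn n. (\<Sum>k<n. (dotp n (g k) y)\<^sup>2) \<le> 1}"
    and "x \<in> Rn n" "x' \<in> Rn n" "int_n n (transl x B) \<inter> int_n n (transl x' B) = {}"
  shows "4 \<le> (\<Sum>k<n. (dotp n (g k) x - dotp n (g k) x')\<^sup>2)"
proof (rule ccontr)
  assume "\<not> ?thesis"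
  then have lt: "(\<Sum>k<n. (dotp n (g k) x - dotp n (g k) x')\<^sup>2) / 4 < 1" by simp
  define q where "q = (\<lambda>t. (1/2) * (x t + x' t))"
  have qR: "q \<in> Rn n" using assms by (auto simp: q_def Rn_def)
  have "(\<Sum>k<n. (dotp n (g k) (\<lambda>t. q t - x t))\<^sup>2) = (\<Sum>k<n. (dotp n (g k) x - dotp n (g k) x')\<^sup>2) / 4"
    unfolding q_def dotp_diff_right dotp_scale_right dotp_add_right sum_divide_distrib
    by (intro sum.cong) (auto simp: power2_eq_square field_simps)
  with lt have "q \<in> int_n n (transl x B)"
    using qR assms(2) by (intro in_int_transl[OF B]) auto
  moreover have "(\<Sum>k<n. (dotp n (g k) (\<lambda>t. q t - x' t))\<^sup>2) = (\<Sum>k<n. (dotp n (g k) x - dotp n (g k) x')\<^sup>2) / 4"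
    unfolding q_def dotp_diff_right dotp_scale_right dotp_add_right sum_divide_distrib
    by (intro sum.cong) (auto simp: power2_eq_square field_simps)
  with lt have "q \<in> int_n n (transl x' B)"
    using qR assms(3) by (intro in_int_transl[OF B]) auto
  ultimately show False using assms(4) by blast
qed

lemma int_n_subset: "int_n n S \<subseteq> S"
proof
  fix x assume "x \<in> int_n n S"
  then obtain e where "x \<in> Rn n" "e > 0" "\<forall>y\<in>Rn n. enorm n (\<lambda>i. y i - x i) < e \<longrightarrow> y \<in> S"
    by (auto simp: int_n_def)
  then show "x \<in> S" by (auto simp: enorm_def)
qed

text \<open>The points \<open>y j\<close> are pulled back to E, and each \<open>\<theta>\<close> to
  a functional h. On the shrunken body h is at most 3/100, less than the gap 1/32 to the hull of the
  earlier points.\<close>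

lemma conv_separated_le_conv_sep_number:
  assumes B: "B = {y \<in> Rn n. (\<Sum>k<n. (dotp n (g k) y)\<^sup>2) \<le> 1}"
    and E: "\<And>t. (\<Sum>k<n. (t k / a k)\<^sup>2) \<le> 1 \<Longrightarrow> \<exists>x\<in>E. \<forall>k<n. dotp n (g k) x = t k"
    and y: "conv_separated n a M y"
  shows "enat M \<le> conv_sep_number n E (scale_set (1/100) B)"
proof -
  \<comment> \<open>The guard \<open>j < M\<close> stands inside the existential so that one
    function can be chosen on all of \<open>nat\<close>.\<close>
  have "\<forall>j. \<exists>x. j < M \<longrightarrow> x \<in> E \<and> (\<forall>k<n. dotp n (g k) x = y j k)"
    using E y unfolding conv_separated_def by meson
  then obtain x where x: "\<And>j. j < M \<Longrightarrow> x j \<in> E"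
    and gx: "\<And>j k. j < M \<Longrightarrow> k < n \<Longrightarrow> dotp n (g k) (x j) = y j k"
    by metis
  have "transl (x j) (int_n n (scale_set (1/100) B)) \<inter> conv {x i | i. i < j} = {}" if j: "j < M" for j
  proof (rule ccontr)
    assume "\<not> ?thesis"
    then obtain v where v: "v \<in> transl (x j) (int_n n (scale_set (1/100) B))" "v \<in> conv {x i | i. i < j}"
      by blast
    obtain b where b: "b \<in> B" "v = (\<lambda>t. x j t + (1/100) * b t)"
      using v(1) int_n_subset[of n "scale_set (1/100) B"] by (auto simp: transl_def scale_set_def)
    obtain k c p where c: "\<And>i. i < (k::nat) \<Longrightarrow> 0 \<le> c i" and p: "\<And>i. i < k \<Longrightarrow> p i \<in> {x i | i. i < j}"
      and c1: "(\<Sum>i<k. c i) = (1::real)" and vp: "v = (\<lambda>t. \<Sum>i<k. c i * p i t)"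
      using v(2) unfolding conv_def by blast
    obtain \<theta> where \<theta>: "(\<Sum>k<n. (\<theta> k)\<^sup>2) \<le> 9"
      and gap: "\<And>i. i < j \<Longrightarrow> (\<Sum>k<n. \<theta> k * y i k) + 1/32 \<le> (\<Sum>k<n. \<theta> k * y j k)"
      using y j unfolding conv_separated_def by blast
    define h where "h = (\<lambda>t. \<Sum>k<n. \<theta> k * g k t)"
    have h: "dotp n h z = (\<Sum>k<n. \<theta> k * dotp n (g k) z)" for z
      unfolding h_def by (rule dotp_sum_left)
    have hx: "dotp n h (x i) = (\<Sum>k<n. \<theta> k * y i k)" if "i < M" for i
      unfolding h using gx[OF that] by simp
    have "(dotp n h b)\<^sup>2 \<le> (\<Sum>k<n. (\<theta> k)\<^sup>2) * (\<Sum>k<n. (dotp n (g k) b)\<^sup>2)"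
      unfolding h by (rule Cauchy_Schwarz_ineq_sum)
    also have "\<dots> \<le> 9 * 1"
      using \<theta> b(1) by (intro mult_mono) (auto simp: B sum_nonneg)
    finally have "\<bar>dotp n h b\<bar> \<le> 3" using abs_le_square_iff[of "dotp n h b" 3] by simp
    then have lower: "dotp n h (x j) - 3/100 \<le> dotp n h v"
      unfolding b(2) dotp_add_right dotp_scale_right by simp
    \<comment> \<open>As a convex combination, v inherits the gap from the earlier points; this
      contradicts \<open>lower\<close>, because 3/100 < 1/32.\<close>
    have "dotp n h v = (\<Sum>i<k. c i * dotp n h (p i))" unfolding vp by (rule dotp_sum_right)
    also have "\<dots> \<le> (\<Sum>i<k. c i * (dotp n h (x j) - 1/32))"
    proof (intro sum_mono mult_left_mono)
      fix i assume i: "i \<in> {..<k}"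
      then obtain l where "l < j" "p i = x l" using p by auto
      then show "dotp n h (p i) \<le> dotp n h (x j) - 1/32"
        using gap[of l] hx[of l] hx[OF j] j by simp
    qed (use c in auto)
    also have "\<dots> = dotp n h (x j) - 1/32" using c1 by (simp flip: sum_distrib_right)
    finally show False using lower by simp
  qed
  then show ?thesis unfolding conv_sep_number_def
    using x by (intro Sup_upper) blast
qed

section \<open>The theorem, with \<open>C = 4\<close> and \<open>c = 1/100\<close>\<close>

theorem theorem2:
  shows "\<exists>C c::real. C > 0 \<and> c > 0 \<and>
    (\<forall>n E B. ellipsoid n E \<and> ellipsoid n B \<longrightarrow>
       (conv_sep_number n E (scale_set c B) = \<infinity> \<or>
        (packing_number n E B \<noteq> \<infinity> \<and>
         log 2 (real (the_enat (packing_number n E B)))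
           \<le> C * log 2 (real (the_enat (conv_sep_number n E (scale_set c B)))))))"
proof -
  \<comment> \<open>An infinite separation number satisfies the first alternative. A finite value m
    bounds the packing number by \<open>m ^ 4\<close>, and the exponent becomes the constant
    C.\<close>
  have main: "packing_number n E B \<noteq> \<infinity> \<and>
         log 2 (real (the_enat (packing_number n E B)))
           \<le> 4 * log 2 (real (the_enat (conv_sep_number n E (scale_set (1/100) B))))"
    if EB: "ellipsoid n E" "ellipsoid n B" and fin: "conv_sep_number n E (scale_set (1/100) B) \<noteq> \<infinity>" for n E B
  proof -
    obtain a g where a: "\<forall>i<n. 0 < a i \<and> a i \<le> a 0"
      and E: "\<forall>x\<in>E. x \<in> Rn n \<and> (\<Sum>k<n. (dotp n (g k) x / a k)\<^sup>2) \<le> 1"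
      and E': "\<forall>t. (\<Sum>k<n. (t k / a k)\<^sup>2) \<le> 1 \<longrightarrow> (\<exists>x\<in>E. \<forall>k<n. dotp n (g k) x = t k)"
      and B: "B = {y \<in> Rn n. (\<Sum>k<n. (dotp n (g k) y)\<^sup>2) \<le> 1}"
      using ellipsoid_pair_coordinates[OF EB] by (elim exE conjE)
    obtain m where m: "conv_sep_number n E (scale_set (1/100) B) = enat m"
      using fin by auto
    have bound: "M \<le> m" if "conv_separated n a M y" for M y
      using conv_separated_le_conv_sep_number[OF B E'[rule_format] that] m by simp
    have "packing_number n E B \<le> enat (m ^ 4)"
      unfolding packing_number_def
    proof (rule Sup_least)
      fix N' assume "N' \<in> {enat N | N. \<exists>x::nat \<Rightarrow> (nat \<Rightarrow> real).
        (\<forall>i<N. x i \<in> E) \<and>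
        (\<forall>i<N. \<forall>j<N. i \<noteq> j \<longrightarrow> int_n n (transl (x i) B) \<inter> int_n n (transl (x j) B) = {})}"
      then obtain N x where N: "N' = enat N" and x: "\<forall>i<N. x i \<in> E"
        and disj: "\<forall>i<N. \<forall>j<N. i \<noteq> j \<longrightarrow>
          int_n n (transl (x i) B) \<inter> int_n n (transl (x j) B) = {}"
        by (elim CollectE exE conjE)
      have "N \<le> m ^ 4"
      proof (rule packing_le_conv_separated[where n = n and a = a and x = "\<lambda>i k. dotp n (g k) (x i)"])
        show "0 < a i \<and> a i \<le> a 0" if "i < n" for i by (rule a[rule_format, OF that])
        show "M \<le> m" if "conv_separated n a M y" for M y using bound that .
        show "(\<Sum>k<n. (dotp n (g k) (x i) / a k)\<^sup>2) \<le> 1" if "i < N" for i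
          using bspec[OF E x[rule_format, OF that]] by (rule conjunct2)
        show "4 \<le> (\<Sum>k<n. (dotp n (g k) (x i) - dotp n (g k) (x j))\<^sup>2)" if "i < N" "j < N" "i \<noteq> j" for i j
          using that bspec[OF E x[rule_format]]
          by (intro disjoint_translates_imp_separated[OF B] disj[rule_format]) simp_all
      qed
      then show "N' \<le> enat (m ^ 4)" by (simp add: N)
    qed
    then obtain p where p: "packing_number n E B = enat p" "p \<le> m ^ 4"
      by (cases "packing_number n E B") auto
    have "log 2 (real p) \<le> 4 * log 2 (real m)"
    \<comment> \<open>\<open>log 2 0\<close> has the value 0 by convention, so zero is treated apart
      from the monotonicity of the logarithm.\<close>
    proof (cases "p = 0")
      case True
      then show ?thesis by (cases "m = 0") (auto simp: log_def)
    next
      case False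
      then have "m > 0" using p(2) by (cases "m = 0") auto
      have "real p \<le> real m ^ 4" using p(2) by (metis of_nat_le_iff of_nat_power)
      then have "log 2 (real p) \<le> log 2 (real m ^ 4)" using False \<open>m > 0\<close> by simp
      also have "\<dots> = 4 * log 2 (real m)" using \<open>m > 0\<close> by (simp add: log_nat_power)
      finally show ?thesis .
    qed
    then show ?thesis using p m by simp
  qed
  show ?thesis
    by (rule exI[of _ 4], rule exI[of _ "1/100"]) (use main in auto)
qed

end
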